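(* Let $R=\{(0,0),(0,1),(0,2),(3,0),(1,1),(1,2),(2,2),(3,1),(3,2)\}$ and $R'=\{(0,0),(1,0),(2,0),(0,3),(1,1),(1,3),(2,1),(2,2),(2,3)\}$. Then $(123,R)\sim_{jd}(132,R)$ and $(123,R')\sim_{jd}(132,R')$.
   Context: $S_n$ is the set of permutations $\pi=\pi_1\cdots\pi_n$ of $\{1,\dots,n\}$. A mesh pattern of length $k$ is a pair $(\tau,R)$ with $\tau\in S_k$ and $R\subseteq\{0,\dots,k\}\times\{0,\dots,k\}$ (the set of shaded boxes; box $(a,b)$ is the unit square with lower-left corner $(a,b)$). An occurrence of $(\tau,R)$ in $\pi\in S_n$ is a subsequence $\pi_{i_1}\cdots\pi_{i_k}$, $i_1<\dots<i_k$, order-isomorphic to $\tau$, such that, with $i_0=0$, $i_{k+1}=n+1$, with $v_1<\dots<v_k$ the values $\pi_{i_1},\dots,\pi_{i_k}$ in increasing order, and $v_0=0$, $v_{k+1}=n+1$, for each $(a,b)\in R$ there is no index $m$ with $i_a<m<i_{a+1}$ and $v_b<\pi_m<v_{b+1}$. Two mesh patterns $q_1,q_2$ are jointly equidistributed, written $q_1\sim_{jd}q_2$, if for all nonnegative integers $n,k,\ell$ the number of $\pi\in S_n$ with exactly $k$ occurrences of $q_1$ and $\ell$ occurrences of $q_2$ equals the number of $\pi\in S_n$ with exactly $\ell$ occurrences of $q_1$ and $k$ occurrences of $q_2$. *)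

theory Defs
  imports Main "HOL-Combinatorics.Multiset_Permutations"
begin

text \<open>
  A permutation of \<open>{1..n}\<close> is its one-line word, i.e. an element of
  \<open>permutations_of_set {1..n}\<close>. Positions are counted from 1, so that position 0 and
  position \<open>n + 1\<close> are free to serve as the boundaries of the diagram.
\<close>

definition entry :: "nat list \<Rightarrow> nat \<Rightarrow> nat" where
  "entry \<pi> i = \<pi> ! (i - 1)"

type_synonym mesh_pattern = "nat list \<times> (nat \<times> nat) set"

definition is_mesh_pattern :: "mesh_pattern \<Rightarrow> bool" where
  "is_mesh_pattern q \<longleftrightarrow>
     (case q of (\<tau>, R) \<Rightarrow>
        \<tau> \<in> permutations_of_set {1..length \<tau>} \<and> R \<subseteq> {0..length \<tau>} \<times> {0..length \<tau>})"

text \<open>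
  \<open>grid n xs\<close> is the sequence \<open>x\<^sub>0, x\<^sub>1, \<dots>, x\<^sub>k, x\<^sub>k\<^sub>+\<^sub>1\<close> with \<open>x\<^sub>0 = 0\<close> and
  \<open>x\<^sub>k\<^sub>+\<^sub>1 = n + 1\<close>, used for the positions as well as for the sorted values of an occurrence.
\<close>

definition grid :: "nat \<Rightarrow> nat list \<Rightarrow> nat \<Rightarrow> nat" where
  "grid n xs a = (0 # xs @ [n + 1]) ! a"

text \<open>
  An occurrence is given by the increasing list \<open>is = [i\<^sub>1, \<dots>, i\<^sub>k]\<close> of its positions.
\<close>

definition is_occurrence :: "mesh_pattern \<Rightarrow> nat list \<Rightarrow> nat list \<Rightarrow> bool" where
  "is_occurrence q \<pi> is \<longleftrightarrow>
     (case q of (\<tau>, R) \<Rightarrow>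
        let n = length \<pi>; k = length \<tau>; vs = sort (map (entry \<pi>) is) in
          length is = k \<and> set is \<subseteq> {1..n} \<and> sorted_wrt (<) is \<and>
          (\<forall>a < k. \<forall>b < k. entry \<pi> (is ! a) < entry \<pi> (is ! b) \<longleftrightarrow> \<tau> ! a < \<tau> ! b) \<and>
          (\<forall>(a, b) \<in> R. \<not> (\<exists>m \<in> {1..n}.
              grid n is a < m \<and> m < grid n is (a + 1) \<and>
              grid n vs b < entry \<pi> m \<and> entry \<pi> m < grid n vs (b + 1))))"

definition occurrences :: "mesh_pattern \<Rightarrow> nat list \<Rightarrow> nat" where
  "occurrences q \<pi> = card {is. is_occurrence q \<pi> is}"

definition jointly_equidistributed :: "mesh_pattern \<Rightarrow> mesh_pattern \<Rightarrow> bool"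
    (infix \<open>\<sim>\<^sub>j\<^sub>d\<close> 50) where
  "q\<^sub>1 \<sim>\<^sub>j\<^sub>d q\<^sub>2 \<longleftrightarrow>
     is_mesh_pattern q\<^sub>1 \<and> is_mesh_pattern q\<^sub>2 \<and>
     (\<forall>n k l.
        card {\<pi> \<in> permutations_of_set {1..n}. occurrences q\<^sub>1 \<pi> = k \<and> occurrences q\<^sub>2 \<pi> = l} =
        card {\<pi> \<in> permutations_of_set {1..n}. occurrences q\<^sub>1 \<pi> = l \<and> occurrences q\<^sub>2 \<pi> = k})"

end

theory Submission
  imports Defs "HOL-Computational_Algebra.Polynomial"
begin

text \<open>
  If an occurrence of either pattern with shading \<open>R\<close> has largest value \<open>m\<close>, then the
  subword of \<open>\<pi>\<close> on the values up to \<open>m\<close> is \<open>a L p X q\<close> with \<open>L < a < min p q\<close> and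
  \<open>X < min p q\<close>, so \<open>m\<close> determines the occurrence and \<open>{p, q} = {m - 1, m}\<close>. Build \<open>\<pi>\<close> by
  successively inserting a new maximum: whether a step creates an occurrence depends only on the
  length of \<open>L\<close> and on whether the previous maximum is the last entry or the first entry
  exceeding \<open>a\<close>. The resulting linear recursion for the bivariate generating function is
  symmetric in its two variables. Transposing the shading corresponds to inverting the
  permutation, since 123 and 132 are involutions; this gives the claim for \<open>R'\<close>.
\<close>

section \<open>A linear recursion and its symmetry in the two weights\<close>

text \<open>
  \<open>state_gf x y k m j e f\<close> counts the ways of inserting \<open>k\<close> further maxima into a word
  \<open>a L p Y\<close> on \<open>{1..m}\<close> with \<open>L < a < p\<close> and \<open>j\<close> the length of \<open>L\<close>; \<open>x\<close> and \<open>y\<close> mark the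
  new occurrences of 123 and 132. The flags \<open>e\<close> and \<open>f\<close> say whether \<open>m\<close> is the last entry and
  whether \<open>m = p\<close>. A new maximum goes to the front, next to \<open>L\<close> before \<open>p\<close>, to the end, or
  to one of the \<open>m - j - 2\<close> slots in between. \<open>max_first_gf\<close> is the case of a word starting with
  \<open>m\<close>.
\<close>

fun state_gf :: "'a::comm_ring_1 \<Rightarrow> 'a \<Rightarrow> nat \<Rightarrow> nat \<Rightarrow> nat \<Rightarrow> bool \<Rightarrow> bool \<Rightarrow> 'a"
  and max_first_gf :: "'a \<Rightarrow> 'a \<Rightarrow> nat \<Rightarrow> nat \<Rightarrow> 'a"
where
  "state_gf x y 0 m j e f = 1"
| "state_gf x y (Suc k) m j e f =
     max_first_gf x y k (Suc m) +
     (if e then y else 1) * (\<Sum>t\<le>j. state_gf x y k (Suc m) t False True) +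
     (if f then x else 1) * state_gf x y k (Suc m) j True False +
     of_nat (m - j - 2) * state_gf x y k (Suc m) j False False"
| "max_first_gf x y 0 m = 1"
| "max_first_gf x y (Suc k) m =
     max_first_gf x y k (Suc m) +
     ((\<Sum>t<m - 1. state_gf x y k (Suc m) t False True) + state_gf x y k (Suc m) (m - 1) True True)"

text \<open>The two flags enter the recursion through different summands, so \<open>state_gf\<close>
  has no mixed term in them. At \<open>k = 0\<close> both sides equal 2.\<close>

lemma state_gf_exchange:
  "state_gf x y k m j True True + state_gf x y k m j False False =
   state_gf x y k m j True False + state_gf x y k m j False True"
  by (cases k) (simp_all add: algebra_simps)

lemma state_gf_last:
  "state_gf x y (Suc k) m j True f =
   state_gf x y (Suc k) m j False f +
   (y - 1) * (\<Sum>t\<le>j. state_gf x y k (Suc m) t False True)"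
  by (simp add: algebra_simps)

lemma state_gf_first:
  "state_gf x y (Suc k) m j e True =
   state_gf x y (Suc k) m j e False + (x - 1) * state_gf x y k (Suc m) j True False"
  by (simp add: algebra_simps)

text \<open>With \<open>Suc m\<close> and \<open>m - 1\<close> for \<open>m\<close> and
  \<open>j\<close>, this is the part of \<open>max_first_gf\<close> that inserts behind the leading
  maximum. For a general \<open>j\<close> the summand with both flags set is formal: a word with
  \<open>p\<close> both maximal and last has \<open>m = j + 2\<close>.\<close>

abbreviation fresh_gf :: "'a::comm_ring_1 \<Rightarrow> 'a \<Rightarrow> nat \<Rightarrow> nat \<Rightarrow> nat \<Rightarrow> 'a" where
  "fresh_gf x y k m j \<equiv>
     (\<Sum>t<j. state_gf x y k m t False True) + state_gf x y k m j True True"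

text \<open>The left side collects the terms that carry the weights \<open>y\<close> and
  \<open>x\<close>. The exchange identity at \<open>t = j\<close> trades them for the neutral value
  and \<open>fresh_gf\<close>, the quantities that turn out to be symmetric.\<close>

lemma sum_first_plus_last:
  "(\<Sum>t\<le>j. state_gf x y k m t False True) + state_gf x y k m j True False =
   state_gf x y k m j False False + fresh_gf x y k m j"
  using state_gf_exchange[of x y k m j]
  by (simp add: lessThan_Suc_atMost[symmetric] algebra_simps)

lemma sum_first_Suc:
  "(\<Sum>t\<le>j. state_gf x y (Suc k) m t False True) =
   (\<Sum>t\<le>j. state_gf x y (Suc k) m t False False) +
   (x - 1) * (\<Sum>t\<le>j. state_gf x y k (Suc m) t True False)"
  by (simp only: state_gf_first sum.distrib sum_distrib_left)

lemma fresh_gf_Suc: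
  "fresh_gf x y (Suc k) m j =
   (\<Sum>t\<le>j. state_gf x y (Suc k) m t False True) +
   (y - 1) * (\<Sum>t\<le>j. state_gf x y k (Suc m) t False True)"
  by (simp only: state_gf_last[where f = True] lessThan_Suc_atMost[symmetric] sum.lessThan_Suc
      add.assoc)

text \<open>After two steps every mixed flag pair can be absorbed by
  \<open>sum_first_plus_last\<close>. What remains are neutral and fresh values whose coefficients
  are the elementary symmetric functions of \<open>x - 1\<close> and \<open>y - 1\<close>.\<close>

lemma fresh_gf_Suc_Suc:
  "fresh_gf x y (Suc (Suc k)) m j =
   (\<Sum>t\<le>j. state_gf x y (Suc (Suc k)) m t False False) +
   (x - 1 + (y - 1)) * (\<Sum>t\<le>j. state_gf x y (Suc k) (Suc m) t False False) +
   (x - 1) * (y - 1) *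
     (\<Sum>t\<le>j. state_gf x y k (Suc (Suc m)) t False False + fresh_gf x y k (Suc (Suc m)) t)"
proof -
  have "(\<Sum>t\<le>j. state_gf x y (Suc k) (Suc m) t True False) =
     (\<Sum>t\<le>j. state_gf x y (Suc k) (Suc m) t False False) +
     (y - 1) * (\<Sum>t\<le>j. \<Sum>u\<le>t. state_gf x y k (Suc (Suc m)) u False True)"
    by (simp only: state_gf_last sum.distrib sum_distrib_left)
  note expand = this
  show ?thesis
    unfolding fresh_gf_Suc sum_first_Suc sum_first_plus_last[symmetric] sum.distrib
    by (simp only: expand) (simp add: algebra_simps del: state_gf.simps)
qed

text \<open>Without flags no weight appears, and the insertions before \<open>p\<close> and at the
  end combine into values covered by the symmetry induction.\<close>

lemma state_gf_neutral_Suc: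
  "state_gf x y (Suc k) m j False False =
   max_first_gf x y k (Suc m) +
   (state_gf x y k (Suc m) j False False + fresh_gf x y k (Suc m) j) +
   of_nat (m - j - 2) * state_gf x y k (Suc m) j False False"
  unfolding sum_first_plus_last[symmetric] by (simp add: add.assoc)

text \<open>The three recursions refer to each other, so the claims are proved together. Strong
  induction is used because \<open>fresh_gf\<close> reaches back two steps.\<close>

lemma gf_symmetric:
  "state_gf x y k m j False False = state_gf y x k m j False False \<and>
   max_first_gf x y k m = max_first_gf y x k m \<and>
   fresh_gf x y k m j = fresh_gf y x k m j"
proof (induction k arbitrary: m j rule: less_induct)
  case (less k)
  note IHs = less.IH[THEN conjunct1] less.IH[THEN conjunct2, THEN conjunct1]
    less.IH[THEN conjunct2, THEN conjunct2]
  consider "k = 0" | k' where "k = Suc k'" by (cases k) auto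
  then show ?case
  proof cases
    case 1
    then show ?thesis by simp
  next
    case (2 k')
    then have k': "k' < k" by simp
    \<comment> \<open>Stated for all \<open>m\<close> and \<open>j\<close>, because the recursion
      for \<open>fresh_gf\<close> sums neutral values with the same \<open>k\<close>.\<close>
    have s: "state_gf x y k m j False False = state_gf y x k m j False False" for m j
      unfolding 2 state_gf_neutral_Suc IHs[OF k'] ..
    have z: "max_first_gf x y k m = max_first_gf y x k m"
      unfolding 2 max_first_gf.simps IHs[OF k'] ..
    have q: "fresh_gf x y k m j = fresh_gf y x k m j"
    proof (cases k')
      \<comment> \<open>For \<open>k = 1\<close> only one step can be unfolded. All values at 0 are
        1, so the weights contribute \<open>j + 1\<close> times
        \<open>(x - 1) + (y - 1)\<close>.\<close>
      case 0
      have "(\<Sum>t\<le>j. state_gf x y (Suc 0) m t False False) = 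
            (\<Sum>t\<le>j. state_gf y x (Suc 0) m t False False)"
        by simp
      then show ?thesis
        unfolding 2 0 fresh_gf_Suc sum_first_Suc by (simp add: algebra_simps)
    next
      case (Suc l)
      then have l: "l < k" using 2 by simp
      show ?thesis
        unfolding 2 Suc fresh_gf_Suc_Suc s[unfolded 2 Suc] IHs[OF k', unfolded Suc] IHs[OF l]
        by (simp only: mult.commute add.commute)
    qed
    from s z q show ?thesis by blast
  qed
qed

section \<open>Words that realize an occurrence ending at their maximum\<close>

text \<open>The relation \<open>r\<close> is \<open>(<)\<close> for the pattern 123 and \<open>(>)\<close> for 132.\<close>

definition core :: "(nat \<Rightarrow> nat \<Rightarrow> bool) \<Rightarrow> nat list \<Rightarrow> bool" where
  "core r \<sigma> \<longleftrightarrow> (\<exists>a L p X q. \<sigma> = a # L @ p # X @ [q] \<and> a < min p q \<and> r p q \<and>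
     (\<forall>x\<in>set L. x < a) \<and> (\<forall>x\<in>set X. x < min p q))"

text \<open>\<open>L\<close> is recovered as the longest prefix of entries below \<open>a\<close>.
  This makes the decomposition in \<open>core\<close> unique.\<close>

lemma split_at_first_greater_unique:
  assumes "L @ p # Y = L' @ p' # Y'" "\<forall>x\<in>set L. x < a" "\<forall>x\<in>set L'. x < a" "a < p" "a < (p'::nat)"
  shows "L = L' \<and> p = p' \<and> Y = Y'"
proof -
  have "takeWhile (\<lambda>x. x < a) (L @ p # Y) = L"
    using assms(2,4) by (subst takeWhile_append2) auto
  moreover have "takeWhile (\<lambda>x. x < a) (L' @ p' # Y') = L'"
    using assms(3,5) by (subst takeWhile_append2) auto
  ultimately have "L = L'" using assms(1) by simp
  with assms(1) show ?thesis by simp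
qed

lemma core_iff:
  assumes "\<forall>x\<in>set L. x < a" "a < p"
  shows "core r (a # L @ p # Y) \<longleftrightarrow>
    Y \<noteq> [] \<and> a < last Y \<and> r p (last Y) \<and> (\<forall>x\<in>set (butlast Y). x < min p (last Y))"
proof
  assume "core r (a # L @ p # Y)"
  then obtain L' p' X q where *: "L @ p # Y = L' @ p' # X @ [q]" "a < min p' q" "r p' q"
    "\<forall>x\<in>set L'. x < a" "\<forall>x\<in>set X. x < min p' q"
    unfolding core_def by auto
  from split_at_first_greater_unique[OF *(1) assms(1) *(4) assms(2)] *(2)
  have "p = p' \<and> Y = X @ [q]" by simp
  with * show "Y \<noteq> [] \<and> a < last Y \<and> r p (last Y) \<and>
    (\<forall>x\<in>set (butlast Y). x < min p (last Y))" by simp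
next
  assume *: "Y \<noteq> [] \<and> a < last Y \<and> r p (last Y) \<and> (\<forall>x\<in>set (butlast Y). x < min p (last Y))"
  show "core r (a # L @ p # Y)"
    unfolding core_def
    by (rule exI[of _ a], rule exI[of _ L], rule exI[of _ p], rule exI[of _ "butlast Y"],
        rule exI[of _ "last Y"]) (use * assms in auto)
qed

lemma not_core_if_head_max:
  assumes "\<forall>x\<in>set L. x < a"
  shows "\<not> core r (a # L)"
  using assms by (fastforce simp: core_def)

section \<open>Building permutations by inserting a new maximum\<close>

definition insert_at :: "nat \<Rightarrow> nat list \<Rightarrow> nat list" where
  "insert_at s \<sigma> = take s \<sigma> @ Suc (length \<sigma>) # drop s \<sigma>"

lemma length_insert_at [simp]: "length (insert_at s \<sigma>) = Suc (length \<sigma>)"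
  by (simp add: insert_at_def)

lemma insert_at_permutation:
  assumes "\<sigma> \<in> permutations_of_set {1..m}"
  shows "insert_at s \<sigma> \<in> permutations_of_set {1..Suc m}"
proof -
  have \<sigma>: "set \<sigma> = {1..m}" "distinct \<sigma>" "length \<sigma> = m"
    using permutations_of_setD[OF assms] length_finite_permutations_of_set[OF assms] by auto
  have U: "set (take s \<sigma>) \<union> set (drop s \<sigma>) = {1..m}"
    by (metis \<sigma>(1) append_take_drop_id set_append)
  have "Suc m \<notin> set (take s \<sigma>) \<union> set (drop s \<sigma>)" unfolding U by simp
  moreover have "distinct (take s \<sigma> @ drop s \<sigma>)" using \<sigma> by simp
  ultimately have "distinct (insert_at s \<sigma>)"
    unfolding insert_at_def \<sigma>(3) distinct_append by auto
  moreover have "set (insert_at s \<sigma>) = {1..Suc m}"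
    unfolding insert_at_def \<sigma>(3) using U by (simp add: atLeastAtMostSuc_conv)
  ultimately show ?thesis by (intro permutations_of_setI)
qed

text \<open>Insertion is inverted by deleting the value \<open>Suc m\<close> and recording how many
  entries stood before it.\<close>

lemma sum_permutations_insert_at:
  "(\<Sum>\<pi>\<in>permutations_of_set {1..Suc m}. g \<pi>) =
   (\<Sum>\<sigma>\<in>permutations_of_set {1..m}. \<Sum>s\<le>m. g (insert_at s \<sigma>))"
proof -
  let ?S = "permutations_of_set {1..m} \<times> {..m}"
  let ?j = "\<lambda>(\<sigma>, s). insert_at s \<sigma>"
  let ?i = "\<lambda>\<pi>. (filter (\<lambda>v. v \<noteq> Suc m) \<pi>, length (takeWhile (\<lambda>v. v \<noteq> Suc m) \<pi>))"
  have 1: "?i (?j z) = z" "?j z \<in> permutations_of_set {1..Suc m}" if zS: "z \<in> ?S" for z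
  proof -
    obtain \<sigma> s where z: "z = (\<sigma>, s)" and \<sigma>: "\<sigma> \<in> permutations_of_set {1..m}" and s: "s \<le> m"
      using zS by blast
    have len: "length \<sigma> = m" and set: "set \<sigma> = {1..m}"
      using permutations_of_setD[OF \<sigma>] length_finite_permutations_of_set[OF \<sigma>] by auto
    have *: "\<forall>v\<in>set (take s \<sigma>). v \<noteq> Suc m" "\<forall>v\<in>set (drop s \<sigma>). v \<noteq> Suc m"
      using set set_take_subset[of s \<sigma>] set_drop_subset[of s \<sigma>] by fastforce+
    then have "filter (\<lambda>v. v \<noteq> Suc m) (insert_at s \<sigma>) = take s \<sigma> @ drop s \<sigma>"
      unfolding insert_at_def len by simp
    moreover have "takeWhile (\<lambda>v. v \<noteq> Suc m) (insert_at s \<sigma>) = take s \<sigma>"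
      unfolding insert_at_def len using * by (subst takeWhile_append2) auto
    ultimately show "?i (?j z) = z" using s len by (simp add: z)
    show "?j z \<in> permutations_of_set {1..Suc m}"
      using insert_at_permutation[OF \<sigma>] by (simp add: z)
  qed
  have 2: "?j (?i \<pi>) = \<pi>" "?i \<pi> \<in> ?S" if "\<pi> \<in> permutations_of_set {1..Suc m}" for \<pi>
  proof -
    have \<pi>: "set \<pi> = {1..Suc m}" "distinct \<pi>" using permutations_of_setD[OF that] by auto
    then have "Suc m \<in> set \<pi>" by simp
    then obtain u v where uv: "\<pi> = u @ Suc m # v" by (meson split_list)
    have n: "Suc m \<notin> set u" "Suc m \<notin> set v" using \<pi> uv by auto
    have f: "filter (\<lambda>v. v \<noteq> Suc m) \<pi> = u @ v"
    proof -
      have "filter (\<lambda>v. v \<noteq> Suc m) u = u" "filter (\<lambda>v. v \<noteq> Suc m) v = v"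
        unfolding filter_id_conv using n by auto
      then show ?thesis by (simp add: uv)
    qed
    have t: "takeWhile (\<lambda>v. v \<noteq> Suc m) \<pi> = u"
      unfolding uv using n by (subst takeWhile_append2) auto
    have "set (u @ v) = set \<pi> - {Suc m}" using uv n by auto
    also have "\<dots> = {1..m}" unfolding \<pi>(1) by auto
    finally have "set (u @ v) = {1..m}" .
    then have p: "u @ v \<in> permutations_of_set {1..m}"
      by (rule permutations_of_setI) (use \<pi> uv in auto)
    then have "length (u @ v) = m" using length_finite_permutations_of_set by fastforce
    then show "?j (?i \<pi>) = \<pi>" "?i \<pi> \<in> ?S"
      using p unfolding f t by (auto simp: insert_at_def uv)
  qed
  have "(\<Sum>\<pi>\<in>permutations_of_set {1..Suc m}. g \<pi>) = (\<Sum>z\<in>?S. g (?j z))"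
    by (rule sum.reindex_bij_witness[where i = ?j and j = ?i]) (use 1 2 in auto)
  then show ?thesis
    by (simp add: sum.cartesian_product case_prod_unfold)
qed

text \<open>Only \<open>core\<close> words created by the \<open>k\<close> insertions are weighted;
  those already present among the smaller values of \<sigma> are left to a separate factor.\<close>

fun extension_gf :: "'a::comm_ring_1 \<Rightarrow> 'a \<Rightarrow> nat \<Rightarrow> nat list \<Rightarrow> 'a" where
  "extension_gf x y 0 \<sigma> = 1"
| "extension_gf x y (Suc k) \<sigma> =
     (\<Sum>s\<le>length \<sigma>. (if core (<) (insert_at s \<sigma>) then x else 1) *
        (if core (>) (insert_at s \<sigma>) then y else 1) * extension_gf x y k (insert_at s \<sigma>))"

text \<open>In a core word with \<open>p < q\<close> all other entries lie below \<open>p\<close>,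
  so \<open>p\<close> and \<open>q\<close> are the two largest values. Conversely, if they are
  \<open>n - 1\<close> and \<open>n\<close>, the bounds on the other entries come for free.\<close>

lemma core_less_permutation:
  assumes "a # L @ p # Y \<in> permutations_of_set {1..n}" "\<forall>x\<in>set L. x < a" "a < p"
  shows "core (<) (a # L @ p # Y) \<longleftrightarrow> Y \<noteq> [] \<and> last Y = n \<and> Suc p = n"
proof (cases Y rule: rev_cases)
  case Nil
  then show ?thesis by (simp add: core_iff[OF assms(2,3)])
next
  case (snoc X q)
  have set: "set (a # L @ p # X @ [q]) = {1..n}" and dist: "distinct (a # L @ p # X @ [q])"
    using permutations_of_setD[OF assms(1)] snoc by auto
  have core: "core (<) (a # L @ p # Y) \<longleftrightarrow> a < q \<and> p < q \<and> (\<forall>x\<in>set X. x < min p q)"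
    by (simp add: core_iff[OF assms(2,3)] snoc)
  show ?thesis
  proof
    assume "core (<) (a # L @ p # Y)"
    then have *: "a < q" "p < q" "\<forall>x\<in>set X. x < p" using core by auto
    have le: "x = q \<or> x \<le> p" if "x \<in> {1..n}" for x
      using that * assms(2,3) unfolding set[symmetric] by fastforce
    have "q \<in> {1..n}" "p \<in> {1..n}" unfolding set[symmetric] by auto
    with le[of n] * have "q = n" by auto
    moreover have "n - 1 \<in> {1..n}"
      using \<open>q = n\<close> \<open>p < q\<close> \<open>p \<in> {1..n}\<close> by auto
    with le[of "n - 1"] \<open>q = n\<close> \<open>p < q\<close> have "Suc p = n" by auto
    ultimately show "Y \<noteq> [] \<and> last Y = n \<and> Suc p = n" using snoc by simp
  next
    assume "Y \<noteq> [] \<and> last Y = n \<and> Suc p = n"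
    then have *: "q = n" "Suc p = n" using snoc by auto
    have "x < p" if "x \<in> set X" for x
    proof -
      have "x \<in> {1..n}" unfolding set[symmetric] using that by auto
      moreover have "x \<noteq> p" "x \<noteq> q" using dist that by auto
      ultimately show ?thesis using * by auto
    qed
    then show "core (<) (a # L @ p # Y)" using * assms(3) core by auto
  qed
qed

text \<open>The same argument with the roles of \<open>p\<close> and the last entry
  exchanged.\<close>

lemma core_greater_permutation:
  assumes "a # L @ p # Y \<in> permutations_of_set {1..n}" "\<forall>x\<in>set L. x < a" "a < p"
  shows "core (>) (a # L @ p # Y) \<longleftrightarrow> Y \<noteq> [] \<and> Suc (last Y) = n \<and> p = n"
proof (cases Y rule: rev_cases)
  case Nil
  then show ?thesis by (simp add: core_iff[OF assms(2,3)])
next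
  case (snoc X q)
  have set: "set (a # L @ p # X @ [q]) = {1..n}" and dist: "distinct (a # L @ p # X @ [q])"
    using permutations_of_setD[OF assms(1)] snoc by auto
  have core: "core (>) (a # L @ p # Y) \<longleftrightarrow> a < q \<and> q < p \<and> (\<forall>x\<in>set X. x < min p q)"
    by (simp add: core_iff[OF assms(2,3)] snoc)
  show ?thesis
  proof
    assume "core (>) (a # L @ p # Y)"
    then have *: "a < q" "q < p" "\<forall>x\<in>set X. x < q" using core by auto
    have le: "x = p \<or> x \<le> q" if "x \<in> {1..n}" for x
      using that * assms(2,3) unfolding set[symmetric] by fastforce
    have "q \<in> {1..n}" "p \<in> {1..n}" unfolding set[symmetric] by auto
    with le[of n] * have "p = n" by auto
    moreover have "n - 1 \<in> {1..n}"
      using \<open>p = n\<close> \<open>q < p\<close> \<open>q \<in> {1..n}\<close> by auto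
    with le[of "n - 1"] \<open>p = n\<close> \<open>q < p\<close> have "Suc q = n" by auto
    ultimately show "Y \<noteq> [] \<and> Suc (last Y) = n \<and> p = n" using snoc by simp
  next
    assume "Y \<noteq> [] \<and> Suc (last Y) = n \<and> p = n"
    then have *: "p = n" "Suc q = n" using snoc by auto
    have "x < q" if "x \<in> set X" for x
    proof -
      have "x \<in> {1..n}" unfolding set[symmetric] using that by auto
      moreover have "x \<noteq> p" "x \<noteq> q" using dist that by auto
      ultimately show ?thesis using * by auto
    qed
    \<comment> \<open>Here \<open>a < p\<close> gives only \<open>a \<le> q\<close>, as
      \<open>p = Suc q\<close>; distinctness excludes equality.\<close>
    moreover have "a < q"
      using dist * assms(3) by auto
    ultimately show "core (>) (a # L @ p # Y)" using * core by auto
  qed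
qed

lemma sum_atMost_split:
  fixes g :: "nat \<Rightarrow> 'a::comm_monoid_add"
  assumes "i < m"
  shows "(\<Sum>s\<le>m. g s) = (\<Sum>s\<le>i. g s) + (\<Sum>s\<in>{Suc i..<m}. g s) + g m"
proof -
  have "{..<m} = {..i} \<union> {Suc i..<m}" using assms by auto
  moreover have "sum g ({..i} \<union> {Suc i..<m}) = sum g {..i} + sum g {Suc i..<m}"
    by (rule sum.union_disjoint) auto
  ultimately show ?thesis by (simp add: lessThan_Suc_atMost[symmetric])
qed

text \<open>Both forms of words need one joint induction: inserting in front always yields a word
  starting with its maximum, and any other slot yields the form \<open>a L p Y\<close>. The slots
  match the summands of the recursion.\<close>

lemma extension_gf_eq:
  assumes "\<sigma> \<in> permutations_of_set {1..m}"
  shows "\<sigma> = m # L \<Longrightarrow> extension_gf x y k \<sigma> = max_first_gf x y k m"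
    and "\<sigma> = a # L @ p # Y \<Longrightarrow> \<forall>v\<in>set L. v < a \<Longrightarrow> a < p \<Longrightarrow>
      extension_gf x y k \<sigma> = state_gf x y k m (length L) (last (p # Y) = m) (p = m)"
  using assms
proof (induction k arbitrary: \<sigma> m a L p Y)
  case 0
  case 1
  show ?case by simp
next
  case 0
  case 2
  show ?case by simp
next
  case (Suc k)
  note IH1 = Suc(1) and IH2 = Suc(2)
  case 1
  note ins = insert_at_permutation[OF 1(2)]
  have len: "length \<sigma> = m" and set: "set \<sigma> = {1..m}" and dist: "distinct \<sigma>"
    using permutations_of_setD[OF 1(2)] length_finite_permutations_of_set[OF 1(2)] by auto
  have lenL: "length L = m - 1" "m > 0" using len 1(1) by auto
  have L: "\<forall>v\<in>set L. v < m"
  proof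
    fix v assume "v \<in> set L"
    then have "v \<in> {1..m}" "v \<noteq> m" using set dist 1(1) by auto
    then show "v < m" by auto
  qed
  let ?w = "\<lambda>s. (if core (<) (insert_at s \<sigma>) then x else 1) *
        (if core (>) (insert_at s \<sigma>) then y else 1) * extension_gf x y k (insert_at s \<sigma>)"
  have front: "?w 0 = max_first_gf x y k (Suc m)"
  proof -
    have eq: "insert_at 0 \<sigma> = Suc m # \<sigma>" by (simp add: insert_at_def len)
    have "\<not> core r (insert_at 0 \<sigma>)" for r
      unfolding eq by (rule not_core_if_head_max) (use set in auto)
    moreover have "extension_gf x y k (insert_at 0 \<sigma>) = max_first_gf x y k (Suc m)"
      by (rule IH1[OF eq ins])
    ultimately show ?thesis by simp
  qed
  \<comment> \<open>The old maximum \<open>m\<close> becomes \<open>a\<close> and the new one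
    becomes \<open>p\<close>. An occurrence would need \<open>m\<close> in the role of
    \<open>p\<close> or at the end, so none arises. Only slot \<open>t = m - 1\<close> puts the new
    maximum last.\<close>
  have other: "?w (Suc t) = state_gf x y k (Suc m) t (t = m - 1) True" if t: "t \<le> m - 1" for t
  proof -
    have eq: "insert_at (Suc t) \<sigma> = m # take t L @ Suc m # drop t L"
      unfolding insert_at_def len by (simp add: 1(1))
    have small: "\<forall>v\<in>set (take t L). v < m" using L by (auto dest: in_set_takeD)
    note ins' = ins[of "Suc t", unfolded eq]
    have dropm: "\<forall>v\<in>set (drop t L). v < m" using L by (auto dest: in_set_dropD)
    have lst: "drop t L \<noteq> [] \<Longrightarrow> last (drop t L) < m"
      using dropm last_in_set by blast
    have "\<not> core (<) (insert_at (Suc t) \<sigma>)"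
      unfolding eq core_less_permutation[OF ins' small lessI] by simp
    moreover have "\<not> core (>) (insert_at (Suc t) \<sigma>)"
      unfolding eq core_greater_permutation[OF ins' small lessI] using lst by auto
    moreover have "extension_gf x y k (insert_at (Suc t) \<sigma>) =
        state_gf x y k (Suc m) (length (take t L)) (last (Suc m # drop t L) = Suc m) (Suc m = Suc m)"
      by (rule IH2[OF eq small lessI ins])
    moreover have "last (Suc m # drop t L) = Suc m \<longleftrightarrow> t = m - 1"
      using lst t lenL by (cases "drop t L = []") auto
    moreover have "length (take t L) = t" using t lenL by simp
    ultimately show ?thesis by simp
  qed
  have "extension_gf x y (Suc k) \<sigma> = (\<Sum>s\<le>Suc (m - 1). ?w s)"
    using lenL(2) by (simp add: len)
  also have "\<dots> = ?w 0 + (\<Sum>t\<le>m - 1. ?w (Suc t))"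
    by (rule sum.atMost_Suc_shift)
  also have "(\<Sum>t\<le>m - 1. ?w (Suc t)) =
      (\<Sum>t\<le>m - 1. state_gf x y k (Suc m) t (t = m - 1) True)"
    by (rule sum.cong) (use other in auto)
  also have "\<dots> = (\<Sum>t<m - 1. state_gf x y k (Suc m) t False True) +
      state_gf x y k (Suc m) (m - 1) True True"
    unfolding lessThan_Suc_atMost[symmetric] sum.lessThan_Suc by simp
  finally show ?case using front by simp
next
  case (Suc k)
  note IH1 = Suc(1) and IH2 = Suc(2)
  case 2
  note \<sigma> = 2(1) and L = 2(2) and ap = 2(3)
  note ins = insert_at_permutation[OF 2(4)]
  have len: "length \<sigma> = m" and set: "set \<sigma> = {1..m}" and dist: "distinct \<sigma>"
    using permutations_of_setD[OF 2(4)] length_finite_permutations_of_set[OF 2(4)] by auto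
  let ?j = "length L"
  have mj: "m = ?j + 2 + length Y" using len \<sigma> by simp
  have le: "v \<le> m" if "v \<in> set \<sigma>" for v using that set by auto
  have am: "a \<le> m" "p \<le> m" by (use le \<sigma> in auto)
  have lastm: "last (p # Y) \<le> m" using le[of "last (p # Y)"] last_in_set[of "p # Y"] \<sigma> by auto
  let ?w = "\<lambda>s. (if core (<) (insert_at s \<sigma>) then x else 1) *
        (if core (>) (insert_at s \<sigma>) then y else 1) * extension_gf x y k (insert_at s \<sigma>)"
  have front: "?w 0 = max_first_gf x y k (Suc m)"
  proof -
    have eq: "insert_at 0 \<sigma> = Suc m # \<sigma>" by (simp add: insert_at_def len)
    have "\<not> core r (insert_at 0 \<sigma>)" for r
      unfolding eq by (rule not_core_if_head_max) (use set in auto)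
    moreover have "extension_gf x y k (insert_at 0 \<sigma>) = max_first_gf x y k (Suc m)"
      by (rule IH1[OF eq ins])
    ultimately show ?thesis by simp
  qed
  \<comment> \<open>The new maximum takes over as \<open>p\<close>, and \<open>L\<close> shrinks to
    its first \<open>t\<close> entries. A 132 arises exactly when the old maximum stands
    last.\<close>
  have early: "?w (Suc t) = (if last (p # Y) = m then y else 1) * state_gf x y k (Suc m) t False True"
    if t: "t \<le> ?j" for t
  proof -
    have eq: "insert_at (Suc t) \<sigma> = a # take t L @ Suc m # (drop t L @ p # Y)"
      unfolding insert_at_def len using t by (simp add: \<sigma>)
    have small: "\<forall>v\<in>set (take t L). v < a" using L by (auto dest: in_set_takeD)
    have aS: "a < Suc m" using am by simp
    note ins' = ins[of "Suc t", unfolded eq]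
    have lst: "last (drop t L @ p # Y) = last (p # Y)" by simp
    have "\<not> core (<) (insert_at (Suc t) \<sigma>)"
      unfolding eq core_less_permutation[OF ins' small aS] by simp
    moreover have "core (>) (insert_at (Suc t) \<sigma>) \<longleftrightarrow> last (p # Y) = m"
      unfolding eq core_greater_permutation[OF ins' small aS] lst by simp
    moreover have "extension_gf x y k (insert_at (Suc t) \<sigma>) =
        state_gf x y k (Suc m) (length (take t L)) (last (Suc m # drop t L @ p # Y) = Suc m)
          (Suc m = Suc m)"
      by (rule IH2[OF eq small aS ins])
    moreover have "last (Suc m # drop t L @ p # Y) \<noteq> Suc m" using lastm by simp
    moreover have "length (take t L) = t" using t by simp
    ultimately show ?thesis by simp
  qed
  \<comment> \<open>Here the new maximum is neither \<open>p\<close> nor last, so nothing is created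
    and both flags are cleared.\<close>
  have middle: "?w s = state_gf x y k (Suc m) ?j False False" if s: "?j + 2 \<le> s" "s < m" for s
  proof -
    \<comment> \<open>The entries \<open>a\<close>, \<open>L\<close> and \<open>p\<close> occupy
      \<open>?j + 2\<close> places; \<open>u\<close> is the slot inside \<open>Y\<close>.\<close>
    define u where "u = s - (?j + 2)"
    have su: "s = Suc (?j + Suc u)" and u: "u < length Y" using s mj by (auto simp: u_def)
    have eq: "insert_at s \<sigma> = a # L @ p # (take u Y @ Suc m # drop u Y)"
      unfolding insert_at_def len su by (simp add: \<sigma>)
    note ins' = ins[of s, unfolded eq]
    have "Y \<noteq> []" using u by auto
    then have "last (take u Y @ Suc m # drop u Y) \<le> m" using u lastm by simp
    then have "\<not> core (<) (insert_at s \<sigma>)"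
      unfolding eq core_less_permutation[OF ins' L ap] by simp
    moreover have "\<not> core (>) (insert_at s \<sigma>)"
      unfolding eq core_greater_permutation[OF ins' L ap] using am by simp
    moreover have "extension_gf x y k (insert_at s \<sigma>) =
        state_gf x y k (Suc m) ?j (last (p # take u Y @ Suc m # drop u Y) = Suc m) (p = Suc m)"
      by (rule IH2[OF eq L ap ins])
    moreover have "last (p # take u Y @ Suc m # drop u Y) \<noteq> Suc m"
      using u lastm \<open>Y \<noteq> []\<close> by simp
    ultimately show ?thesis using am by simp
  qed
  \<comment> \<open>The new maximum plays the 3 of a 123 exactly when the old maximum is
    \<open>p\<close>.\<close>
  have at_end: "?w m = (if p = m then x else 1) * state_gf x y k (Suc m) ?j True False"
  proof -
    have eq: "insert_at m \<sigma> = a # L @ p # (Y @ [Suc m])"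
      unfolding insert_at_def len using len by (simp add: \<sigma>)
    note ins' = ins[of m, unfolded eq]
    have "core (<) (insert_at m \<sigma>) \<longleftrightarrow> p = m"
      unfolding eq core_less_permutation[OF ins' L ap] by simp
    moreover have "\<not> core (>) (insert_at m \<sigma>)"
      unfolding eq core_greater_permutation[OF ins' L ap] by simp
    moreover have "extension_gf x y k (insert_at m \<sigma>) =
        state_gf x y k (Suc m) ?j (last (p # Y @ [Suc m]) = Suc m) (p = Suc m)"
      by (rule IH2[OF eq L ap ins])
    ultimately show ?thesis using am by simp
  qed
  have split: "(\<Sum>s\<le>m. g s) = (\<Sum>s\<le>Suc ?j. g s) + (\<Sum>s\<in>{?j + 2..<m}. g s) + g m"
    for g :: "nat \<Rightarrow> 'a"
    using sum_atMost_split[of "Suc ?j" m g] mj by simp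
  have "extension_gf x y (Suc k) \<sigma> = (\<Sum>s\<le>m. ?w s)" by (simp add: len)
  also have "\<dots> = (\<Sum>s\<le>Suc ?j. ?w s) + (\<Sum>s\<in>{?j + 2..<m}. ?w s) + ?w m"
    by (rule split)
  also have "(\<Sum>s\<le>Suc ?j. ?w s) = ?w 0 + (\<Sum>t\<le>?j. ?w (Suc t))"
    by (rule sum.atMost_Suc_shift)
  also have "(\<Sum>t\<le>?j. ?w (Suc t)) =
      (\<Sum>t\<le>?j. (if last (p # Y) = m then y else 1) * state_gf x y k (Suc m) t False True)"
    by (rule sum.cong) (use early in auto)
  also have "(\<Sum>s\<in>{?j + 2..<m}. ?w s) = of_nat (m - ?j - 2) * state_gf x y k (Suc m) ?j False False"
    using middle by (simp add: diff_diff_left)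
  finally show ?case
    unfolding front at_end state_gf.simps sum_distrib_left by (simp add: algebra_simps)
qed

section \<open>The joint generating function over all permutations\<close>

text \<open>Each counted \<open>m\<close> stands for the occurrence with largest value
  \<open>m\<close>; the filtered word is the stage of the construction at which \<open>m\<close> was
  inserted.\<close>

definition core_count :: "(nat \<Rightarrow> nat \<Rightarrow> bool) \<Rightarrow> nat list \<Rightarrow> nat" where
  "core_count r \<pi> = card {m \<in> set \<pi>. core r (filter (\<lambda>v. v \<le> m) \<pi>)}"

text \<open>The subwords on values up to \<open>m\<close> are unchanged by the insertion, so only
  the full word can contribute anew.\<close>

lemma core_count_insert_at:
  assumes "\<sigma> \<in> permutations_of_set {1..m}"
  shows "core_count r (insert_at s \<sigma>) =
    core_count r \<sigma> + (if core r (insert_at s \<sigma>) then 1 else 0)"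
proof -
  let ?A = "\<lambda>\<pi>. {m \<in> set \<pi>. core r (filter (\<lambda>v. v \<le> m) \<pi>)}"
  have set: "set \<sigma> = {1..m}" and len: "length \<sigma> = m"
    using permutations_of_setD[OF assms] length_finite_permutations_of_set[OF assms] by auto
  have set': "set (insert_at s \<sigma>) = {1..Suc m}"
    using permutations_of_setD[OF insert_at_permutation[OF assms]] by auto
  have top: "filter (\<lambda>v. v \<le> Suc m) (insert_at s \<sigma>) = insert_at s \<sigma>"
    unfolding filter_id_conv set' by simp
  have low: "filter (\<lambda>v. v \<le> i) (insert_at s \<sigma>) = filter (\<lambda>v. v \<le> i) \<sigma>" if "i \<le> m" for i
  proof -
    have "filter (\<lambda>v. v \<le> i) (insert_at s \<sigma>) = filter (\<lambda>v. v \<le> i) (take s \<sigma> @ drop s \<sigma>)"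
      using that unfolding insert_at_def len filter_append by simp
    then show ?thesis by simp
  qed
  have "?A (insert_at s \<sigma>) = ?A \<sigma> \<union> (if core r (insert_at s \<sigma>) then {Suc m} else {})"
    unfolding set set' using top low by (auto simp: le_Suc_eq)
  moreover have "Suc m \<notin> ?A \<sigma>" unfolding set by simp
  ultimately show ?thesis by (simp add: core_count_def)
qed

text \<open>Each induction step moves one insertion from \<open>extension_gf\<close> into the outer
  sum. The total \<open>m + k\<close> stays fixed while \<open>m\<close> grows, hence
  \<open>m\<close> is arbitrary.\<close>

lemma sum_permutations_extension_gf:
  "(\<Sum>\<pi>\<in>permutations_of_set {1..m + k}. x ^ core_count (<) \<pi> * y ^ core_count (>) \<pi>) =
   (\<Sum>\<sigma>\<in>permutations_of_set {1..m}.
      x ^ core_count (<) \<sigma> * y ^ core_count (>) \<sigma> * extension_gf x y k \<sigma>)"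
proof (induction k arbitrary: m)
  case 0
  show ?case by simp
next
  case (Suc k)
  have "(\<Sum>\<sigma>\<in>permutations_of_set {1..Suc m}.
      x ^ core_count (<) \<sigma> * y ^ core_count (>) \<sigma> * extension_gf x y k \<sigma>) =
    (\<Sum>\<sigma>\<in>permutations_of_set {1..m}. \<Sum>s\<le>m.
      x ^ core_count (<) (insert_at s \<sigma>) * y ^ core_count (>) (insert_at s \<sigma>) *
      extension_gf x y k (insert_at s \<sigma>))"
    by (rule sum_permutations_insert_at)
  also have "\<dots> = (\<Sum>\<sigma>\<in>permutations_of_set {1..m}.
      x ^ core_count (<) \<sigma> * y ^ core_count (>) \<sigma> * extension_gf x y (Suc k) \<sigma>)"
  proof (rule sum.cong[OF refl])
    fix \<sigma> assume \<sigma>: "\<sigma> \<in> permutations_of_set {1..m}"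
    have len: "length \<sigma> = m" using length_finite_permutations_of_set[OF \<sigma>] by simp
    show "(\<Sum>s\<le>m. x ^ core_count (<) (insert_at s \<sigma>) * y ^ core_count (>) (insert_at s \<sigma>) *
        extension_gf x y k (insert_at s \<sigma>)) =
      x ^ core_count (<) \<sigma> * y ^ core_count (>) \<sigma> * extension_gf x y (Suc k) \<sigma>"
      unfolding extension_gf.simps len sum_distrib_left core_count_insert_at[OF \<sigma>]
      by (rule sum.cong[OF refl]) (simp add: ac_simps)
  qed
  finally show ?case using Suc.IH[of "Suc m"] by simp
qed

text \<open>Every nonempty permutation grows from the word \<open>[1]\<close>, which starts with its
  maximum, so the whole sum is the value \<open>max_first_gf x y k 1\<close>.\<close>

lemma core_count_gf_symmetric:
  fixes x y :: "'a::comm_ring_1"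
  shows "(\<Sum>\<pi>\<in>permutations_of_set {1..n}. x ^ core_count (<) \<pi> * y ^ core_count (>) \<pi>) =
    (\<Sum>\<pi>\<in>permutations_of_set {1..n}. y ^ core_count (<) \<pi> * x ^ core_count (>) \<pi>)"
proof (cases n)
  case 0
  then show ?thesis by (simp add: core_count_def)
next
  case (Suc k)
  have "core_count r [1] = 0" for r
    by (simp add: core_count_def core_def Cons_eq_append_conv)
  moreover have "extension_gf x y k [1] = max_first_gf x y k 1" for x y :: 'a
    by (rule extension_gf_eq(1)[of _ 1 "[]"]) simp_all
  ultimately have "(\<Sum>\<pi>\<in>permutations_of_set {1..n}. x ^ core_count (<) \<pi> * y ^ core_count (>) \<pi>) =
      max_first_gf x y k 1" for x y :: 'a
    using sum_permutations_extension_gf[of x y 1 k] Suc by simp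
  then show ?thesis using gf_symmetric[of x y k 1] by metis
qed

section \<open>From symmetric polynomials to symmetric counts\<close>

lemma joint_distribution_symmetric:
  fixes f g :: "'b \<Rightarrow> nat"
  assumes "finite S"
    and sym: "\<And>x y :: int poly poly. (\<Sum>s\<in>S. x ^ f s * y ^ g s) = (\<Sum>s\<in>S. y ^ f s * x ^ g s)"
  shows "card {s \<in> S. f s = k \<and> g s = l} = card {s \<in> S. f s = l \<and> g s = k}"
proof -
  \<comment> \<open>\<open>?x\<close> is the inner variable seen as a constant and \<open>?y\<close>
    the outer one. Hence the outer coefficient index is the exponent of \<open>?y\<close>.\<close>
  let ?x = "[:monom 1 1:] :: int poly poly" and ?y = "monom 1 1 :: int poly poly"
  have mon: "?x ^ a * ?y ^ b = monom (monom 1 a) b" for a b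
    by (simp add: poly_const_pow monom_power smult_monom)
  have coeff: "coeff (coeff (\<Sum>s\<in>S. ?x ^ f s * ?y ^ g s) l) k =
      int (card {s \<in> S. f s = k \<and> g s = l})" for f g :: "'b \<Rightarrow> nat"
  proof -
    have "coeff (coeff (\<Sum>s\<in>S. ?x ^ f s * ?y ^ g s) l) k =
        (\<Sum>s\<in>S. if f s = k \<and> g s = l then 1 else 0)"
      unfolding mon coeff_sum by (rule sum.cong) auto
    also have "\<dots> = int (card (S \<inter> {s. f s = k \<and> g s = l}))"
      using assms(1) by (simp add: sum.If_cases)
    also have "S \<inter> {s. f s = k \<and> g s = l} = {s \<in> S. f s = k \<and> g s = l}" by auto
    finally show ?thesis .
  qed
  have "(\<Sum>s\<in>S. ?x ^ f s * ?y ^ g s) = (\<Sum>s\<in>S. ?x ^ g s * ?y ^ f s)"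
    using sym[of ?x ?y] by (simp only: mult.commute)
  then have "int (card {s \<in> S. f s = k \<and> g s = l}) = int (card {s \<in> S. g s = k \<and> f s = l})"
    by (simp only: coeff[symmetric])
  then show ?thesis by (simp add: conj_commute)
qed

section \<open>Mesh occurrences as values counted by \<open>core_count\<close>\<close>

text \<open>Positions count from 1, so \<open>s\<close> fills exactly the positions strictly between
  \<open>i\<close> and \<open>j\<close>. Empty \<open>p\<close> and \<open>q\<close> give the
  boundaries 0 and \<open>n + 1\<close>. A column of the mesh thereby becomes a factor of the
  word.\<close>

lemma ex_entry_between:
  assumes \<pi>: "\<pi> = p @ s @ q" and i: "i = length p" and j: "j = Suc (length p + length s)"
    and n: "n = length \<pi>"
  shows "(\<exists>m\<in>{1..n}. i < m \<and> m < j \<and> lo < entry \<pi> m \<and> entry \<pi> m < hi) \<longleftrightarrow>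
    (\<exists>x\<in>set s. lo < x \<and> x < hi)" (is "?l \<longleftrightarrow> ?r")
proof
  assume ?l
  then obtain m where m: "i < m" "m < j" "lo < entry \<pi> m \<and> entry \<pi> m < hi" by blast
  then have "entry \<pi> m = s ! (m - 1 - length p)" "m - 1 - length p < length s"
    by (auto simp: entry_def nth_append \<pi> i j)
  with m(3) show ?r by (metis nth_mem)
next
  assume ?r
  then obtain t where t: "t < length s" "lo < s ! t" "s ! t < hi" by (metis in_set_conv_nth)
  have "entry \<pi> (Suc (length p + t)) = s ! t" using t(1) by (simp add: entry_def nth_append \<pi>)
  with t show ?l by (intro bexI[of _ "Suc (length p + t)"]) (auto simp: \<pi> i j n)
qed

lemma split_list_at_three_positions:
  assumes "length is = 3" "set is \<subseteq> {1..length \<pi>}" "sorted_wrt (<) is"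
  obtains u0 a u1 p u2 q u3 where
    "\<pi> = u0 @ a # u1 @ p # u2 @ q # u3"
    "is = [Suc (length u0), Suc (Suc (length u0 + length u1)),
      Suc (Suc (Suc (length u0 + length u1 + length u2)))]"
proof -
  from assms(1) obtain i j k where is_eq: "is = [i, j, k]"
    by (auto simp: numeral_3_eq_3 length_Suc_conv)
  have ord: "1 \<le> i" "i < j" "j < k" "k \<le> length \<pi>" using assms is_eq by auto
  let ?d = "drop i \<pi>"
  let ?e = "drop j \<pi>"
  have 1: "\<pi> = take (i - 1) \<pi> @ \<pi> ! (i - 1) # ?d"
    using ord id_take_nth_drop[of "i - 1" \<pi>] by simp
  have 2: "?d = take (j - i - 1) ?d @ \<pi> ! (j - 1) # ?e"
    using ord id_take_nth_drop[of "j - i - 1" ?d] by simp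
  have 3: "?e = take (k - j - 1) ?e @ \<pi> ! (k - 1) # drop k \<pi>"
    using ord id_take_nth_drop[of "k - j - 1" ?e] by simp
  show thesis
  proof (rule that)
    show "\<pi> = take (i - 1) \<pi> @ \<pi> ! (i - 1) # take (j - i - 1) ?d @ \<pi> ! (j - 1) #
        take (k - j - 1) ?e @ \<pi> ! (k - 1) # drop k \<pi>"
      using 1 2 3 by metis
  qed (use is_eq ord in auto)
qed

abbreviation (input) mesh_R :: "(nat \<times> nat) set" where
  "mesh_R \<equiv> {(0,0), (0,1), (0,2), (3,0), (1,1), (1,2), (2,2), (3,1), (3,2)}"

text \<open>The outer columns are shaded below the largest value, column 1 between \<open>a\<close>
  and it, column 2 between the two larger values. Other entries differ from \<open>a\<close>,
  \<open>p\<close>, \<open>q\<close>, so avoiding adjacent open boxes means avoiding their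
  union.\<close>

lemma mesh_R_avoided_iff:
  assumes \<pi>: "\<pi> = u0 @ a # u1 @ p # u2 @ q # u3" and perm: "\<pi> \<in> permutations_of_set {1..n}"
    and is_eq: "is = [Suc (length u0), Suc (Suc (length u0 + length u1)),
      Suc (Suc (Suc (length u0 + length u1 + length u2)))]"
    and a: "a < min p q"
  shows "(\<forall>(c, d) \<in> mesh_R. \<not> (\<exists>m \<in> {1..n}.
              grid n is c < m \<and> m < grid n is (c + 1) \<and>
              grid n [a, min p q, max p q] d < entry \<pi> m \<and>
              entry \<pi> m < grid n [a, min p q, max p q] (d + 1))) \<longleftrightarrow>
    (\<forall>x\<in>set u0. max p q < x) \<and> (\<forall>x\<in>set u1. x < a \<or> max p q < x) \<and>
    (\<forall>x\<in>set u2. x < min p q \<or> max p q < x) \<and> (\<forall>x\<in>set u3. max p q < x)"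
proof -
  have n: "n = length \<pi>" using length_finite_permutations_of_set[OF perm] by simp
  have set: "set \<pi> = {1..n}" and dist: "distinct \<pi>" using permutations_of_setD[OF perm] by auto
  let ?i1 = "Suc (length u0)" and ?i2 = "Suc (Suc (length u0 + length u1))"
    and ?i3 = "Suc (Suc (Suc (length u0 + length u1 + length u2)))"
  have c0: "(\<exists>m\<in>{1..n}. 0 < m \<and> m < ?i1 \<and> lo < entry \<pi> m \<and> entry \<pi> m < hi) \<longleftrightarrow>
      (\<exists>x\<in>set u0. lo < x \<and> x < hi)" for lo hi
    by (rule ex_entry_between[where p = "[]" and q = "a # u1 @ p # u2 @ q # u3"]) (simp_all add: n \<pi>)
  have c1: "(\<exists>m\<in>{1..n}. ?i1 < m \<and> m < ?i2 \<and> lo < entry \<pi> m \<and> entry \<pi> m < hi) \<longleftrightarrow>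
      (\<exists>x\<in>set u1. lo < x \<and> x < hi)" for lo hi
    by (rule ex_entry_between[where p = "u0 @ [a]" and q = "p # u2 @ q # u3"]) (simp_all add: n \<pi>)
  have c2: "(\<exists>m\<in>{1..n}. ?i2 < m \<and> m < ?i3 \<and> lo < entry \<pi> m \<and> entry \<pi> m < hi) \<longleftrightarrow>
      (\<exists>x\<in>set u2. lo < x \<and> x < hi)" for lo hi
    by (rule ex_entry_between[where p = "u0 @ a # u1 @ [p]" and q = "q # u3"]) (simp_all add: n \<pi>)
  have c3: "(\<exists>m\<in>{1..n}. ?i3 < m \<and> m < Suc n \<and> lo < entry \<pi> m \<and> entry \<pi> m < hi) \<longleftrightarrow>
      (\<exists>x\<in>set u3. lo < x \<and> x < hi)" for lo hi
    by (rule ex_entry_between[where p = "u0 @ a # u1 @ p # u2 @ [q]" and q = "[]"]) (simp_all add: n \<pi>)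
  let ?lo = "min p q" and ?hi = "max p q"
  have other: "0 < x \<and> x \<noteq> a \<and> x \<noteq> ?lo \<and> x \<noteq> ?hi"
    if "x \<in> set u0 \<union> set u1 \<union> set u2 \<union> set u3" for x
  proof -
    have "x \<in> {1..n}" unfolding set[symmetric] \<pi> using that by auto
    moreover have "x \<noteq> a" "x \<noteq> p" "x \<noteq> q" using that dist unfolding \<pi> by auto
    ultimately show ?thesis by (auto simp: min_def max_def)
  qed
  have lohi: "?lo \<le> ?hi" by simp
  have "(\<forall>(c, d) \<in> mesh_R. \<not> (\<exists>m \<in> {1..n}.
              grid n is c < m \<and> m < grid n is (c + 1) \<and>
              grid n [a, ?lo, ?hi] d < entry \<pi> m \<and> entry \<pi> m < grid n [a, ?lo, ?hi] (d + 1))) \<longleftrightarrow>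
    (\<forall>x\<in>set u0. \<not> (0 < x \<and> x < a) \<and> \<not> (a < x \<and> x < ?lo) \<and> \<not> (?lo < x \<and> x < ?hi)) \<and>
    (\<forall>x\<in>set u1. \<not> (a < x \<and> x < ?lo) \<and> \<not> (?lo < x \<and> x < ?hi)) \<and>
    (\<forall>x\<in>set u2. \<not> (?lo < x \<and> x < ?hi)) \<and>
    (\<forall>x\<in>set u3. \<not> (0 < x \<and> x < a) \<and> \<not> (a < x \<and> x < ?lo) \<and> \<not> (?lo < x \<and> x < ?hi))"
  proof -
    have grid_is: "grid n is 0 = 0" "grid n is (0 + 1) = ?i1" "grid n is 1 = ?i1"
      "grid n is (1 + 1) = ?i2" "grid n is 2 = ?i2" "grid n is (2 + 1) = ?i3"
      "grid n is 3 = ?i3" "grid n is (3 + 1) = Suc n"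
      unfolding is_eq grid_def by simp_all
    have grid_v: "grid n [a, ?lo, ?hi] 0 = 0" "grid n [a, ?lo, ?hi] (0 + 1) = a"
      "grid n [a, ?lo, ?hi] 1 = a" "grid n [a, ?lo, ?hi] (1 + 1) = ?lo"
      "grid n [a, ?lo, ?hi] 2 = ?lo" "grid n [a, ?lo, ?hi] (2 + 1) = ?hi"
      unfolding grid_def by simp_all
    show ?thesis
      unfolding ball_simps prod.case grid_is grid_v c0 c1 c2 c3 by (simp only: ball_conj_distrib bex_simps) blast
  qed
  also have "\<dots> \<longleftrightarrow> (\<forall>x\<in>set u0. ?hi < x) \<and> (\<forall>x\<in>set u1. x < a \<or> ?hi < x) \<and>
    (\<forall>x\<in>set u2. x < ?lo \<or> ?hi < x) \<and> (\<forall>x\<in>set u3. ?hi < x)"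
  proof -
    have col03: "(\<not> (0 < x \<and> x < u) \<and> \<not> (u < x \<and> x < v) \<and> \<not> (v < x \<and> x < w)) \<longleftrightarrow> w < x"
      and col1: "(\<not> (u < x \<and> x < v) \<and> \<not> (v < x \<and> x < w)) \<longleftrightarrow> x < u \<or> w < x"
      and col2: "\<not> (v < x \<and> x < w) \<longleftrightarrow> x < v \<or> w < x"
      if "0 < x \<and> x \<noteq> u \<and> x \<noteq> v \<and> x \<noteq> w" "u < v" "v \<le> w" for u v w x :: nat
      using that by auto
    show ?thesis
    proof (intro arg_cong2[where f = conj] ball_cong refl)
      fix x assume "x \<in> set u0"
      then show "(\<not> (0 < x \<and> x < a) \<and> \<not> (a < x \<and> x < ?lo) \<and> \<not> (?lo < x \<and> x < ?hi)) \<longleftrightarrow> ?hi < x"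
        by (intro col03 other a lohi) simp
    next
      fix x assume "x \<in> set u1"
      then show "(\<not> (a < x \<and> x < ?lo) \<and> \<not> (?lo < x \<and> x < ?hi)) \<longleftrightarrow> x < a \<or> ?hi < x"
        by (intro col1 other a lohi) simp
    next
      fix x assume "x \<in> set u2"
      then show "\<not> (?lo < x \<and> x < ?hi) \<longleftrightarrow> x < ?lo \<or> ?hi < x"
        by (intro col2[of x a] other a lohi) simp
    next
      fix x assume "x \<in> set u3"
      then show "(\<not> (0 < x \<and> x < a) \<and> \<not> (a < x \<and> x < ?lo) \<and> \<not> (?lo < x \<and> x < ?hi)) \<longleftrightarrow> ?hi < x"
        by (intro col03 other a lohi) simp
    qed
  qed
  finally show ?thesis .
qed

lemma is_occurrence_iff:
  assumes r: "(\<tau>, r) = ([1,2,3], (<)) \<or> (\<tau>, r) = ([1,3,2], (>))"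
    and perm: "\<pi> \<in> permutations_of_set {1..n}"
    and \<pi>: "\<pi> = u0 @ a # u1 @ p # u2 @ q # u3"
    and is_eq: "is = [Suc (length u0), Suc (Suc (length u0 + length u1)),
      Suc (Suc (Suc (length u0 + length u1 + length u2)))]"
  shows "is_occurrence (\<tau>, mesh_R) \<pi> is \<longleftrightarrow> a < min p q \<and> r p q \<and>
    (\<forall>x\<in>set u0. max p q < x) \<and> (\<forall>x\<in>set u1. x < a \<or> max p q < x) \<and>
    (\<forall>x\<in>set u2. x < min p q \<or> max p q < x) \<and> (\<forall>x\<in>set u3. max p q < x)"
proof -
  have n: "length \<pi> = n" using length_finite_permutations_of_set[OF perm] by simp
  have dist: "a \<noteq> p" "p \<noteq> q" "a \<noteq> q" using permutations_of_setD[OF perm] \<pi> by auto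
  have entries: "entry \<pi> (Suc (length u0)) = a"
    "entry \<pi> (Suc (Suc (length u0 + length u1))) = p"
    "entry \<pi> (Suc (Suc (Suc (length u0 + length u1 + length u2)))) = q"
    by (simp_all add: \<pi> entry_def nth_append)
  have len: "length \<tau> = 3" using r by auto
  have pos: "length is = 3 \<and> set is \<subseteq> {1..n} \<and> sorted_wrt (<) is"
    unfolding n[symmetric] by (simp add: \<pi> is_eq)
  have three: "(\<forall>b<3. P b) \<longleftrightarrow> P 0 \<and> P 1 \<and> P (2::nat)" for P
    by (auto simp: numeral_3_eq_3 less_Suc_eq numeral_2_eq_2)
  have iso: "(\<forall>b<3. \<forall>c<3. entry \<pi> (is ! b) < entry \<pi> (is ! c) \<longleftrightarrow> \<tau> ! b < \<tau> ! c) \<longleftrightarrow>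
      a < min p q \<and> r p q"
    unfolding three using r dist by (auto simp: is_eq entries)
  \<comment> \<open>The sorted values are known only if \<open>a\<close> is smallest. Otherwise the
    order condition already fails on both sides.\<close>
  have sort: "sort (map (entry \<pi>) is) = [a, min p q, max p q]" if "a < min p q"
    using that by (auto simp: is_eq entries)
  show ?thesis
  proof (cases "a < min p q \<and> r p q")
    case True
    then have "a < min p q" by simp
    note mesh_R_avoided_iff[OF \<pi> perm is_eq this]
    with True sort iso pos show ?thesis
      unfolding is_occurrence_def Let_def prod.case len n by simp
  next
    case False
    with iso show ?thesis unfolding is_occurrence_def Let_def prod.case len n by blast
  qed
qed

lemma bij_betw_entry:
  assumes "\<pi> \<in> permutations_of_set {1..n}"
  shows "bij_betw (entry \<pi>) {1..n} {1..n}"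
proof -
  have n: "length \<pi> = n" and set: "set \<pi> = {1..n}" and dist: "distinct \<pi>"
    using permutations_of_setD[OF assms] length_finite_permutations_of_set[OF assms] by auto
  have "bij_betw ((!) \<pi>) {..<n} {1..n}"
    using bij_betw_nth[OF dist] n set by auto
  moreover have "bij_betw (\<lambda>i. i - 1) {1..n} {..<n}"
    by (rule bij_betwI[where g = Suc]) auto
  ultimately have "bij_betw ((!) \<pi> \<circ> (\<lambda>i. i - 1)) {1..n} {1..n}"
    by (rule bij_betw_trans[rotated])
  then show ?thesis by (simp add: comp_def entry_def[abs_def])
qed

text \<open>Lifts a decomposition of the subword on small values to one of the whole
  permutation.\<close>

lemma filter_eq_append_ConsD:
  "filter P ys = L @ x # xs \<Longrightarrow>
    \<exists>us vs. ys = us @ x # vs \<and> filter P us = L \<and> P x \<and> filter P vs = xs"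
proof (induction L arbitrary: ys)
  case Nil
  then show ?case by (auto simp: filter_eq_Cons_iff filter_empty_conv)
next
  case (Cons l L)
  then obtain us vs where 1: "ys = us @ l # vs" "\<forall>u\<in>set us. \<not> P u" "P l"
    "filter P vs = L @ x # xs"
    by (auto simp: filter_eq_Cons_iff)
  from Cons.IH[OF 1(4)] obtain us' vs' where
    "vs = us' @ x # vs'" "filter P us' = L" "P x" "filter P vs' = xs" by blast
  with 1 show ?case by (intro exI[of _ "us @ l # us'"] exI[of _ vs']) simp
qed

text \<open>An occurrence is sent to its largest value \<open>m\<close>. Conversely \<open>m\<close>
  determines the subword, the subword its unique entries \<open>a\<close>, \<open>p\<close>,
  \<open>q\<close>, and these their positions.\<close>

lemma occurrences_eq_core_count:
  assumes r: "(\<tau>, r) = ([1,2,3], (<)) \<or> (\<tau>, r) = ([1,3,2], (>))"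
    and perm: "\<pi> \<in> permutations_of_set {1..n}"
  shows "occurrences (\<tau>, mesh_R) \<pi> = core_count r \<pi>"
proof -
  let ?max = "\<lambda>is. Max (set (map (entry \<pi>) is))"
  let ?f = "\<lambda>m. filter (\<lambda>v. v \<le> m) \<pi>"
  have n: "length \<pi> = n" using length_finite_permutations_of_set[OF perm] by simp
  have len: "length \<tau> = 3" using r by auto
  have positions: "length is = 3" "set is \<subseteq> {1..n}" "sorted_wrt (<) is"
    if "is_occurrence (\<tau>, mesh_R) \<pi> is" for "is"
    using that unfolding is_occurrence_def Let_def prod.case len n by simp_all
  \<comment> \<open>Filtering at the largest value erases the outer factors entirely. By the
    shading, the survivors between the chosen entries are small enough to serve as \<open>L\<close>
    and \<open>X\<close>.\<close>
  have core: "\<exists>a L p X q. ?f (?max is) = a # L @ p # X @ [q] \<and> a < min p q \<and> r p q \<and>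
      (\<forall>x\<in>set L. x < a) \<and> (\<forall>x\<in>set X. x < min p q) \<and> map (entry \<pi>) is = [a, p, q]"
    if occ: "is_occurrence (\<tau>, mesh_R) \<pi> is" for "is"
  proof -
    obtain u0 a u1 p u2 q u3 where \<pi>: "\<pi> = u0 @ a # u1 @ p # u2 @ q # u3"
      and is_eq: "is = [Suc (length u0), Suc (Suc (length u0 + length u1)),
        Suc (Suc (Suc (length u0 + length u1 + length u2)))]"
      using split_list_at_three_positions[of "is" \<pi>] positions[OF occ] n by metis
    have *: "a < min p q" "r p q" "\<forall>x\<in>set u0. max p q < x" "\<forall>x\<in>set u1. x < a \<or> max p q < x"
      "\<forall>x\<in>set u2. x < min p q \<or> max p q < x" "\<forall>x\<in>set u3. max p q < x"
      using occ is_occurrence_iff[OF r perm \<pi> is_eq] by auto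
    have entries: "map (entry \<pi>) is = [a, p, q]"
      by (simp add: is_eq \<pi> entry_def nth_append)
    have max: "?max is = max p q" unfolding entries using *(1) by (auto simp: max_def)
    let ?g = "filter (\<lambda>v. v \<le> max p q)"
    have "?g u0 = []" "?g u3 = []" using *(3,6) by (simp_all add: filter_empty_conv not_le)
    then have "?g \<pi> = a # ?g u1 @ p # ?g u2 @ [q]"
      unfolding \<pi> using *(1) by (simp add: le_max_iff_disj)
    then have "?f (?max is) = a # ?g u1 @ p # ?g u2 @ [q]" unfolding max .
    moreover have "\<forall>x\<in>set (?g u1). x < a" "\<forall>x\<in>set (?g u2). x < min p q"
      using *(4,5) unfolding set_filter not_less[symmetric] by blast+
    ultimately show ?thesis
      using *(1,2) entries
      by - (rule exI[of _ a], rule exI[of _ "?g u1"], rule exI[of _ p], rule exI[of _ "?g u2"],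
        rule exI[of _ q], intro conjI)
  qed
  have "bij_betw ?max {is. is_occurrence (\<tau>, mesh_R) \<pi> is} {m \<in> set \<pi>. core r (?f m)}"
  proof (rule bij_betwI')
    fix "is" js
    assume "is \<in> {is. is_occurrence (\<tau>, mesh_R) \<pi> is}" "js \<in> {is. is_occurrence (\<tau>, mesh_R) \<pi> is}"
    then have occ: "is_occurrence (\<tau>, mesh_R) \<pi> is" "is_occurrence (\<tau>, mesh_R) \<pi> js" by auto
    show "?max is = ?max js \<longleftrightarrow> is = js"
    proof
      assume eq: "?max is = ?max js"
      obtain a L p X q where 1: "?f (?max is) = a # L @ p # X @ [q]" "a < min p q"
        "\<forall>x\<in>set L. x < a" "map (entry \<pi>) is = [a, p, q]" using core[OF occ(1)]
        by (elim exE conjE) (rule that; assumption)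
      obtain a' L' p' X' q' where 2: "?f (?max js) = a' # L' @ p' # X' @ [q']" "a' < min p' q'"
        "\<forall>x\<in>set L'. x < a'" "map (entry \<pi>) js = [a', p', q']" using core[OF occ(2)]
        by (elim exE conjE) (rule that; assumption)
      have a: "a = a'" and rest: "L @ p # X @ [q] = L' @ p' # X' @ [q']"
        using 1(1) 2(1) eq by simp_all
      have "L = L' \<and> p = p' \<and> X @ [q] = X' @ [q']"
        by (rule split_at_first_greater_unique[OF rest 1(3)]) (use 1(2) 2(2,3) a in auto)
      with a 1(4) 2(4) have "map (entry \<pi>) is = map (entry \<pi>) js" by simp
      moreover have "inj_on (entry \<pi>) (set is \<union> set js)"
        by (rule inj_on_subset[OF bij_betw_imp_inj_on[OF bij_betw_entry[OF perm]]])
          (use positions(2)[OF occ(1)] positions(2)[OF occ(2)] in blast)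
      ultimately show "is = js" by (rule map_inj_on)
    qed simp
  next
    fix "is" assume "is \<in> {is. is_occurrence (\<tau>, mesh_R) \<pi> is}"
    then have occ: "is_occurrence (\<tau>, mesh_R) \<pi> is" by simp
    obtain a L p X q where *: "?f (?max is) = a # L @ p # X @ [q]" "a < min p q" "r p q"
      "\<forall>x\<in>set L. x < a" "\<forall>x\<in>set X. x < min p q" "map (entry \<pi>) is = [a, p, q]"
      using core[OF occ] by (elim exE conjE) (rule that; assumption)
    have "core r (?f (?max is))" unfolding *(1) by (subst core_iff) (use * in auto)
    moreover have "{p, q} \<subseteq> set (?f (?max is))" unfolding *(1) by simp
    then have "{p, q} \<subseteq> set \<pi>" by auto
    then have "max p q \<in> set \<pi>" by (simp add: max_def)
    moreover have "?max is = max p q" using *(2,6) by (auto simp: max_def)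
    ultimately show "?max is \<in> {m \<in> set \<pi>. core r (?f m)}" by simp
  next
    fix m assume "m \<in> {m \<in> set \<pi>. core r (?f m)}"
    then obtain a L p X q where m: "m \<in> set \<pi>" and f: "?f m = a # L @ p # X @ [q]"
      and *: "a < min p q" "r p q" "\<forall>x\<in>set L. x < a" "\<forall>x\<in>set X. x < min p q"
      unfolding core_def by blast
    obtain u0 v0 where 0: "\<pi> = u0 @ a # v0" "filter (\<lambda>v. v \<le> m) u0 = []"
      "filter (\<lambda>v. v \<le> m) v0 = L @ p # X @ [q]"
      using filter_eq_append_ConsD[of _ \<pi> "[]", unfolded append_Nil, OF f] by auto
    obtain u1 v1 where 1: "v0 = u1 @ p # v1" "filter (\<lambda>v. v \<le> m) u1 = L"
      "filter (\<lambda>v. v \<le> m) v1 = X @ [q]"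
      using filter_eq_append_ConsD[OF 0(3)] by auto
    obtain u2 u3 where 2: "v1 = u2 @ q # u3" "filter (\<lambda>v. v \<le> m) u2 = X"
      "filter (\<lambda>v. v \<le> m) u3 = []"
      using filter_eq_append_ConsD[OF 1(3)] by auto
    have \<pi>: "\<pi> = u0 @ a # u1 @ p # u2 @ q # u3" using 0 1 2 by simp
    \<comment> \<open>The value \<open>m\<close> survives its own filter, and no entry of a core
      word exceeds \<open>max p q\<close>.\<close>
    have mmax: "m = max p q"
    proof (rule antisym)
      have "m \<in> set (?f m)" using m by simp
      then show "m \<le> max p q" unfolding f using * by fastforce
      have "set (?f m) \<subseteq> {..m}" by auto
      then show "max p q \<le> m" unfolding f by simp
    qed
    have cols: "\<forall>x\<in>set u0. m < x" "\<forall>x\<in>set u3. m < x" "\<forall>x\<in>set u1. x < a \<or> m < x"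
      "\<forall>x\<in>set u2. x < min p q \<or> m < x"
      using 0(2) 2(3) *(3,4) unfolding 1(2)[symmetric] 2(2)[symmetric]
      by (auto simp: filter_empty_conv not_le)
    define "is" where "is = [Suc (length u0), Suc (Suc (length u0 + length u1)),
        Suc (Suc (Suc (length u0 + length u1 + length u2)))]"
    have "is_occurrence (\<tau>, mesh_R) \<pi> is"
      unfolding is_occurrence_iff[OF r perm \<pi> is_def] using cols * mmax by simp
    moreover have "map (entry \<pi>) is = [a, p, q]"
      by (simp add: is_def \<pi> entry_def nth_append)
    then have "m = ?max is" using mmax *(1) by (auto simp: max_def)
    ultimately show "\<exists>is\<in>{is. is_occurrence (\<tau>, mesh_R) \<pi> is}. m = ?max is" by blast
  qed
  then show ?thesis
    unfolding occurrences_def core_count_def by (rule bij_betw_same_card)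
qed

section \<open>Inverse permutations and the transposed shading\<close>

definition inverse_word :: "nat list \<Rightarrow> nat list" where
  "inverse_word \<pi> = map (inv_into {1..length \<pi>} (entry \<pi>)) [1..<Suc (length \<pi>)]"

lemma entry_inverse_word:
  assumes "\<pi> \<in> permutations_of_set {1..n}" "v \<in> {1..n}"
  shows "entry (inverse_word \<pi>) v = inv_into {1..n} (entry \<pi>) v"
  using assms(2) length_finite_permutations_of_set[OF assms(1)]
  by (auto simp: entry_def inverse_word_def simp del: upt_Suc)

lemma inverse_word_permutation:
  assumes "\<pi> \<in> permutations_of_set {1..n}"
  shows "inverse_word \<pi> \<in> permutations_of_set {1..n}"
proof (rule permutations_of_setI)
  have n: "length \<pi> = n" using length_finite_permutations_of_set[OF assms] by simp
  have bij: "bij_betw (inv_into {1..n} (entry \<pi>)) {1..n} {1..n}"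
    by (rule bij_betw_inv_into[OF bij_betw_entry[OF assms]])
  have set: "set [1..<Suc n] = {1..n}" by auto
  show "set (inverse_word \<pi>) = {1..n}"
    unfolding inverse_word_def n set_map set using bij by (rule bij_betw_imp_surj_on)
  show "distinct (inverse_word \<pi>)"
    unfolding inverse_word_def n distinct_map set using bij_betw_imp_inj_on[OF bij] by simp
qed

lemma entry_inverse_word_entry:
  assumes "\<pi> \<in> permutations_of_set {1..n}" "i \<in> {1..n}"
  shows "entry (inverse_word \<pi>) (entry \<pi> i) = i"
proof -
  note bij = bij_betw_entry[OF assms(1)]
  have "entry \<pi> i \<in> {1..n}" using bij assms(2) by (rule bij_betw_apply)
  then show ?thesis
    using entry_inverse_word[OF assms(1)] bij_betw_inv_into_left[OF bij assms(2)] by simp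
qed

lemma entry_entry_inverse_word:
  assumes "\<pi> \<in> permutations_of_set {1..n}" "v \<in> {1..n}"
  shows "entry \<pi> (entry (inverse_word \<pi>) v) = v"
  using entry_inverse_word[OF assms] bij_betw_inv_into_right[OF bij_betw_entry[OF assms(1)] assms(2)]
  by simp

lemma inverse_word_inverse_word:
  assumes "\<pi> \<in> permutations_of_set {1..n}"
  shows "inverse_word (inverse_word \<pi>) = \<pi>"
proof (rule nth_equalityI)
  note inv = inverse_word_permutation[OF assms]
  note inv2 = inverse_word_permutation[OF inv]
  have n: "length \<pi> = n" using length_finite_permutations_of_set[OF assms] by simp
  show len: "length (inverse_word (inverse_word \<pi>)) = length \<pi>"
    using length_finite_permutations_of_set[OF inv2] n by simp
  fix i assume "i < length (inverse_word (inverse_word \<pi>))"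
  then have i: "Suc i \<in> {1..n}" using len n by simp
  have p: "entry \<pi> (Suc i) \<in> {1..n}" using bij_betw_entry[OF assms] i by (rule bij_betw_apply)
  have "entry (inverse_word (inverse_word \<pi>)) (Suc i) = entry \<pi> (Suc i)"
    using entry_inverse_word_entry[OF inv p] entry_inverse_word_entry[OF assms i] by simp
  then show "inverse_word (inverse_word \<pi>) ! i = \<pi> ! i" by (simp add: entry_def)
qed

text \<open>Inversion reflects the diagram in its diagonal: sorted values become positions,
  positions become sorted values, and box \<open>(a, b)\<close> becomes \<open>(b, a)\<close>. The
  underlying patterns are kept because 123 and 132 are involutions.\<close>

lemma is_occurrence_inverse_word:
  assumes \<tau>: "\<tau> = [1,2,3] \<or> \<tau> = [1,3,2]" and perm: "\<pi> \<in> permutations_of_set {1..n}"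
    and occ: "is_occurrence (\<tau>, R) \<pi> is"
  defines "vs \<equiv> sort (map (entry \<pi>) is)"
  shows "is_occurrence (\<tau>, R\<inverse>) (inverse_word \<pi>) vs"
    and "sort (map (entry (inverse_word \<pi>)) vs) = is"
proof -
  let ?\<rho> = "inverse_word \<pi>"
  note inv = inverse_word_permutation[OF perm]
  have n: "length \<pi> = n" "length ?\<rho> = n"
    using length_finite_permutations_of_set[OF perm] length_finite_permutations_of_set[OF inv] by auto
  have len: "length \<tau> = 3" using \<tau> by auto
  have pos: "length is = 3" "set is \<subseteq> {1..n}" "sorted_wrt (<) is"
    and iso: "\<And>a b. a < 3 \<Longrightarrow> b < 3 \<Longrightarrow> entry \<pi> (is ! a) < entry \<pi> (is ! b) \<longleftrightarrow> \<tau> ! a < \<tau> ! b"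
    and avoid: "\<forall>(a, b) \<in> R. \<not> (\<exists>m \<in> {1..n}. grid n is a < m \<and> m < grid n is (a + 1) \<and>
              grid n vs b < entry \<pi> m \<and> entry \<pi> m < grid n vs (b + 1))"
    using occ unfolding is_occurrence_def Let_def prod.case len n vs_def[symmetric] by blast+
  have inj: "inj_on (entry \<pi>) {1..n}" and img: "entry \<pi> ` {1..n} = {1..n}"
    using bij_betw_entry[OF perm] by (auto simp: bij_betw_def)
  have setvs: "set vs = entry \<pi> ` set is" by (simp add: vs_def)
  have vs_sub: "set vs \<subseteq> {1..n}" using setvs pos(2) img by blast
  have dist_is: "distinct is" using pos(3) by (simp add: strict_sorted_iff)
  have "distinct (map (entry \<pi>) is)"
    using dist_is inj_on_subset[OF inj pos(2)] by (simp add: distinct_map)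
  then have "distinct vs" by (simp add: vs_def)
  then have sorted_vs: "sorted_wrt (<) vs" by (simp add: strict_sorted_iff vs_def)
  have lenvs: "length vs = 3" using pos(1) by (simp add: vs_def)
  have inv_entry: "entry ?\<rho> (entry \<pi> i) = i" if "i \<in> set is" for i
    using entry_inverse_word_entry[OF perm] that pos(2) by blast
  have set_back: "set (map (entry ?\<rho>) vs) = set is"
    unfolding set_map setvs image_image using inv_entry by simp
  have inj': "inj_on (entry ?\<rho>) {1..n}"
    using bij_betw_entry[OF inv] by (simp add: bij_betw_def)
  show sort_back: "sort (map (entry ?\<rho>) vs) = is"
  proof (rule sorted_distinct_set_unique)
    show "distinct (sort (map (entry ?\<rho>) vs))"
      using \<open>distinct vs\<close> inj_on_subset[OF inj' vs_sub] by (simp add: distinct_map)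
  qed (use set_back pos(3) in \<open>simp_all add: strict_sorted_iff\<close>)
  obtain i j k where is_eq: "is = [i, j, k]"
    using pos(1) by (auto simp: numeral_3_eq_3 length_Suc_conv)
  have ijk: "i < j" "j < k" using pos(3) is_eq by auto
  have three: "(\<forall>b<3. P b) \<longleftrightarrow> P 0 \<and> P 1 \<and> P (2::nat)" for P
    by (auto simp: numeral_3_eq_3 less_Suc_eq numeral_2_eq_2)
  have iso': "\<forall>a<3. \<forall>b<3. entry ?\<rho> (vs ! a) < entry ?\<rho> (vs ! b) \<longleftrightarrow> \<tau> ! a < \<tau> ! b"
    using \<tau>
  proof
    assume t: "\<tau> = [1,2,3]"
    then have "entry \<pi> i < entry \<pi> j" "entry \<pi> j < entry \<pi> k"
      using iso[of 0 1] iso[of 1 2] by (auto simp: is_eq)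
    then have "vs = [entry \<pi> i, entry \<pi> j, entry \<pi> k]" by (simp add: vs_def is_eq)
    then show ?thesis unfolding three using ijk by (simp add: inv_entry is_eq t)
  next
    assume t: "\<tau> = [1,3,2]"
    then have "entry \<pi> i < entry \<pi> k" "entry \<pi> k < entry \<pi> j"
      using iso[of 0 2] iso[of 2 1] by (auto simp: is_eq)
    then have "vs = [entry \<pi> i, entry \<pi> k, entry \<pi> j]" by (simp add: vs_def is_eq)
    then show ?thesis unfolding three using ijk by (simp add: inv_entry is_eq t)
  qed
  \<comment> \<open>The point at position \<open>v\<close> of the inverse is the point of \<pi> at
    position \<open>entry ?\<rho> v\<close> with value \<open>v\<close>, so it would lie in a shaded
    box of the original occurrence.\<close>
  have avoid': "\<forall>(b, a) \<in> R\<inverse>. \<not> (\<exists>v \<in> {1..n}. grid n vs b < v \<and> v < grid n vs (b + 1) \<and>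
              grid n is a < entry ?\<rho> v \<and> entry ?\<rho> v < grid n is (a + 1))"
  proof clarify
    fix b a v
    assume R: "(a, b) \<in> R" and v: "v \<in> {1..n}" and
      *: "grid n vs b < v" "v < grid n vs (b + 1)"
      "grid n is a < entry ?\<rho> v" "entry ?\<rho> v < grid n is (a + 1)"
    have "entry ?\<rho> v \<in> {1..n}" using bij_betw_entry[OF inv] v by (rule bij_betw_apply)
    moreover have "entry \<pi> (entry ?\<rho> v) = v" by (rule entry_entry_inverse_word[OF perm v])
    ultimately show False using avoid R * by fastforce
  qed
  show "is_occurrence (\<tau>, R\<inverse>) ?\<rho> vs"
    unfolding is_occurrence_def Let_def prod.case len n sort_back
    using lenvs vs_sub sorted_vs iso' avoid' by blast
qed

text \<open>Applying the transfer of occurrences to the inverse word as well yields the inverse map,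
  since inverting twice and transposing twice both do nothing.\<close>

lemma occurrences_inverse_word:
  assumes \<tau>: "\<tau> = [1,2,3] \<or> \<tau> = [1,3,2]" and perm: "\<pi> \<in> permutations_of_set {1..n}"
  shows "occurrences (\<tau>, R\<inverse>) (inverse_word \<pi>) = occurrences (\<tau>, R) \<pi>"
proof -
  note inv = inverse_word_permutation[OF perm]
  note invol = inverse_word_inverse_word[OF perm]
  have "bij_betw (\<lambda>is. sort (map (entry \<pi>) is)) {is. is_occurrence (\<tau>, R) \<pi> is}
      {is. is_occurrence (\<tau>, R\<inverse>) (inverse_word \<pi>) is}"
  proof (rule bij_betwI[where g = "\<lambda>vs. sort (map (entry (inverse_word \<pi>)) vs)"])
    show "(\<lambda>vs. sort (map (entry (inverse_word \<pi>)) vs))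
        \<in> {is. is_occurrence (\<tau>, R\<inverse>) (inverse_word \<pi>) is} \<rightarrow> {is. is_occurrence (\<tau>, R) \<pi> is}"
      using is_occurrence_inverse_word(1)[OF \<tau> inv, of "R\<inverse>"] by (auto simp: invol)
  next
    fix vs assume "vs \<in> {is. is_occurrence (\<tau>, R\<inverse>) (inverse_word \<pi>) is}"
    then show "sort (map (entry \<pi>) (sort (map (entry (inverse_word \<pi>)) vs))) = vs"
      using is_occurrence_inverse_word(2)[OF \<tau> inv, of "R\<inverse>" vs] by (simp add: invol)
  qed (use is_occurrence_inverse_word[OF \<tau> perm] in auto)
  then show ?thesis unfolding occurrences_def by (rule bij_betw_same_card[symmetric])
qed

text \<open>Inversion permutes the permutations of \<open>{1..n}\<close> and transports both counts
  at once, so it preserves the joint distribution.\<close>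

lemma jointly_equidistributed_converse:
  assumes jd: "([1,2,3], R) \<sim>\<^sub>j\<^sub>d ([1,3,2], R)"
  shows "([1,2,3], R\<inverse>) \<sim>\<^sub>j\<^sub>d ([1,3,2], R\<inverse>)"
proof -
  have pat: "is_mesh_pattern ([1,2,3], R\<inverse>)" "is_mesh_pattern ([1,3,2], R\<inverse>)"
    using jd by (auto simp: jointly_equidistributed_def is_mesh_pattern_def)
  have "card {\<pi> \<in> permutations_of_set {1..n}.
        occurrences ([1,2,3], R\<inverse>) \<pi> = k \<and> occurrences ([1,3,2], R\<inverse>) \<pi> = l} =
      card {\<pi> \<in> permutations_of_set {1..n}.
        occurrences ([1,2,3], R) \<pi> = k \<and> occurrences ([1,3,2], R) \<pi> = l}" for n k l
  proof (rule bij_betw_same_card[symmetric], rule bij_betwI[where f = inverse_word and g = inverse_word])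
    have "occurrences (\<tau>, R) (inverse_word \<pi>) = occurrences (\<tau>, R\<inverse>) \<pi>"
      if "\<tau> = [1,2,3] \<or> \<tau> = [1,3,2]" "\<pi> \<in> permutations_of_set {1..n}" for \<tau> \<pi>
      using occurrences_inverse_word[OF that, of "R\<inverse>"] by simp
    then show "inverse_word \<in> {\<pi> \<in> permutations_of_set {1..n}.
        occurrences ([1,2,3], R\<inverse>) \<pi> = k \<and> occurrences ([1,3,2], R\<inverse>) \<pi> = l} \<rightarrow>
      {\<pi> \<in> permutations_of_set {1..n}.
        occurrences ([1,2,3], R) \<pi> = k \<and> occurrences ([1,3,2], R) \<pi> = l}"
      using inverse_word_permutation by auto
  qed (use occurrences_inverse_word inverse_word_permutation inverse_word_inverse_word in auto)
  with jd pat show ?thesis unfolding jointly_equidistributed_def by metis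
qed

theorem theorem3p3:
  fixes R R' :: "(nat \<times> nat) set"
  assumes "R = {(0,0), (0,1), (0,2), (3,0), (1,1), (1,2), (2,2), (3,1), (3,2)}"
    and "R' = {(0,0), (1,0), (2,0), (0,3), (1,1), (1,3), (2,1), (2,2), (2,3)}"
  shows "([1,2,3], R) \<sim>\<^sub>j\<^sub>d ([1,3,2], R) \<and> ([1,2,3], R') \<sim>\<^sub>j\<^sub>d ([1,3,2], R')"
proof -
  have pat: "is_mesh_pattern ([1,2,3], mesh_R)" "is_mesh_pattern ([1,3,2], mesh_R)"
    by (auto simp: is_mesh_pattern_def permutations_of_set_def)
  have "card {\<pi> \<in> permutations_of_set {1..n}.
        occurrences ([1,2,3], mesh_R) \<pi> = k \<and> occurrences ([1,3,2], mesh_R) \<pi> = l} =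
      card {\<pi> \<in> permutations_of_set {1..n}.
        occurrences ([1,2,3], mesh_R) \<pi> = l \<and> occurrences ([1,3,2], mesh_R) \<pi> = k}" for n k l
  proof -
    have "{\<pi> \<in> permutations_of_set {1..n}.
        occurrences ([1,2,3], mesh_R) \<pi> = k \<and> occurrences ([1,3,2], mesh_R) \<pi> = l} =
      {\<pi> \<in> permutations_of_set {1..n}. core_count (<) \<pi> = k \<and> core_count (>) \<pi> = l}" for k l
      using occurrences_eq_core_count[of "[1,2,3]" "(<)" _ n]
        occurrences_eq_core_count[of "[1,3,2]" "(>)" _ n] by auto
    then show ?thesis
      using joint_distribution_symmetric[OF finite_permutations_of_set core_count_gf_symmetric]
      by presburger
  qed
  with pat have 1: "([1,2,3], mesh_R) \<sim>\<^sub>j\<^sub>d ([1,3,2], mesh_R)"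
    unfolding jointly_equidistributed_def by blast
  have "mesh_R\<inverse> = R'" unfolding assms(2) by auto
  with 1 jointly_equidistributed_converse[OF 1] assms(1) show ?thesis by simp
qed

end
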